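(* For almost all complex symmetric $5\times 5$ matrices $F$ (i.e. for all $F$ in some nonempty Zariski-open subset of the space of complex symmetric $5\times5$ matrices), the Lagrangian subspaces $V_L(F)\subset V_u$ determined by $F$ all belong to one single orbit of the gauge group $\mathrm{Sp}(2,\mathbb C)^{\times 5}$ acting on Lagrangian subspaces of $V_u$.
   Context: Let $u=12345$ be a pentachoron (4-simplex) with vertices $1,\dots,5$; it has five 3-faces (tetrahedra) $t$. To each $t$ attach one complex variable $x_t$ and the two-dimensional symplectic space $V_t=\mathrm{span}_{\mathbb C}\{\partial_t,x_t\}$ of operators, where $\partial_t=\partial/\partial x_t$, $x_t$ is the multiplication operator, and the symplectic product is the commutator. Put $V_u=\bigoplus_{t\subset u}V_t$ (10-dimensional, symplectic product = commutator). A Lagrangian subspace of $V_u$ is a maximal subspace all of whose elements commute with each other. A symmetric $5\times5$ complex matrix $F=(F_{tt'})$, with rows and columns indexed by the tetrahedra, determines the Lagrangian subspace $$V_L(F)=\mathrm{span}\Bigl\{\partial_t+\sum_{t'}F_{tt'}x_{t'}\;:\;t\subset u\Bigr\},$$ consisting of operators annihilating the Gaussian exponential $\exp(-\tfrac12\mathsf x^{\mathrm T}F\mathsf x)$. The gauge group $\mathrm{Sp}(2,\mathbb C)^{\times5}$ acts on $V_u$ with one factor $\mathrm{Sp}(2,\mathbb C)$ acting naturally on each summand $V_t$; it maps Lagrangian subspaces to Lagrangian subspaces. *)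

theory Defs
  imports
    "HOL-Analysis.Analysis"
    "HOL-Algebra.Group_Action"
    "HOL-Algebra.Product_Groups"
    "HOL-Library.Function_Algebras"
begin

text \<open>
  A 3-face of the pentachoron \<open>12345\<close> is labelled by the vertex opposite to it. In the numeral
  type the vertex \<open>5\<close> is the element \<open>5 = 0\<close>.
\<close>

type_synonym tet = 5

type_synonym fn = "complex ^ tet \<Rightarrow> complex"

type_synonym oprt = "fn \<Rightarrow> fn"


subsection \<open>The operators\<close>

text \<open>
  The operators act on the smallest algebra of entire functions of the variables \<open>x\<^sub>t\<close> that contains
  the polynomials and is closed under the exponential function. It is stable under
  differentiation and contains the Gaussian exponentials. Operators are extended by \<open>0\<close> to the
  functions outside this algebra, so that equal operators are equal elements of \<^typ>\<open>oprt\<close>.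
\<close>

inductive_set exp_algebra :: "fn set" where
  const: "(\<lambda>x. c) \<in> exp_algebra"
| coord: "(\<lambda>x. x $ t) \<in> exp_algebra"
| add: "f \<in> exp_algebra \<Longrightarrow> g \<in> exp_algebra \<Longrightarrow> (\<lambda>x. f x + g x) \<in> exp_algebra"
| mult: "f \<in> exp_algebra \<Longrightarrow> g \<in> exp_algebra \<Longrightarrow> (\<lambda>x. f x * g x) \<in> exp_algebra"
| exp: "f \<in> exp_algebra \<Longrightarrow> (\<lambda>x. exp (f x)) \<in> exp_algebra"

definition partial_deriv :: "tet \<Rightarrow> fn \<Rightarrow> fn" where
  "partial_deriv t f = (\<lambda>x. deriv (\<lambda>z. f (\<chi> s. if s = t then z else x $ s)) (x $ t))"

definition D_op :: "tet \<Rightarrow> oprt" where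
  "D_op t = (\<lambda>f. if f \<in> exp_algebra then partial_deriv t f else 0)"

definition X_op :: "tet \<Rightarrow> oprt" where
  "X_op t = (\<lambda>f. if f \<in> exp_algebra then (\<lambda>x. x $ t * f x) else 0)"

definition op_scale :: "complex \<Rightarrow> oprt \<Rightarrow> oprt" where
  "op_scale c A = (\<lambda>f x. c * A f x)"

interpretation oprt: vector_space op_scale
  by unfold_locales (auto simp: op_scale_def fun_eq_iff algebra_simps)

definition commutator :: "oprt \<Rightarrow> oprt \<Rightarrow> oprt" where
  "commutator A B = (A \<circ> B) - (B \<circ> A)"


subsection \<open>The symplectic space and its Lagrangian subspaces\<close>

definition V_tet :: "tet \<Rightarrow> oprt set" where
  "V_tet t = oprt.span {D_op t, X_op t}"

definition V_u :: "oprt set" where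
  "V_u = {\<Sum>t\<in>UNIV. A t | A. \<forall>t. A t \<in> V_tet t}"

definition commuting_subspace :: "oprt set \<Rightarrow> bool" where
  "commuting_subspace L \<longleftrightarrow>
     oprt.subspace L \<and> L \<subseteq> V_u \<and> (\<forall>A\<in>L. \<forall>B\<in>L. commutator A B = 0)"

definition lagrangian :: "oprt set \<Rightarrow> bool" where
  "lagrangian L \<longleftrightarrow>
     commuting_subspace L \<and> (\<forall>L'. commuting_subspace L' \<and> L \<subseteq> L' \<longrightarrow> L' = L)"

definition V_L :: "complex ^ tet ^ tet \<Rightarrow> oprt set" where
  "V_L F = oprt.span
     (range (\<lambda>t. D_op t + (\<Sum>t'\<in>UNIV. op_scale (F $ t $ t') (X_op t'))))"


subsection \<open>The gauge group and its action\<close>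

text \<open>
  The matrix \<open>J\<close> is that of the commutator on \<open>V\<^sub>t\<close> in the basis \<open>(\<partial>\<^sub>t, x\<^sub>t)\<close>, as \<open>[\<partial>\<^sub>t, x\<^sub>t] = 1\<close>.
\<close>

definition J2 :: "complex ^ 2 ^ 2" where
  "J2 = vector [vector [0, 1], vector [-1, 0]]"

definition Sp2 :: "(complex ^ 2 ^ 2) monoid" where
  "Sp2 = \<lparr>carrier = {M. transpose M ** J2 ** M = J2}, mult = (**), one = mat 1\<rparr>"

definition gauge_group :: "(tet \<Rightarrow> complex ^ 2 ^ 2) monoid" where
  "gauge_group = product_group UNIV (\<lambda>_. Sp2)"

definition op_of :: "tet \<Rightarrow> complex ^ 2 \<Rightarrow> oprt" where
  "op_of t w = op_scale (w $ 1) (D_op t) + op_scale (w $ 2) (X_op t)"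

text \<open>
  The coordinates \<open>w t\<close> below are determined by the element of \<open>V\<^sub>u\<close>, the operators \<open>\<partial>\<^sub>t\<close>, \<open>x\<^sub>t\<close> being
  linearly independent.
\<close>

definition gauge_image :: "(tet \<Rightarrow> complex ^ 2 ^ 2) \<Rightarrow> oprt set \<Rightarrow> oprt set" where
  "gauge_image M L =
     {\<Sum>t\<in>UNIV. op_of t (M t *v w t) | w. (\<Sum>t\<in>UNIV. op_of t (w t)) \<in> L}"

text \<open>Restricted because \<^const>\<open>group_action\<close> requires extensional maps.\<close>

definition gauge_action :: "(tet \<Rightarrow> complex ^ 2 ^ 2) \<Rightarrow> oprt set \<Rightarrow> oprt set" where
  "gauge_action M = (\<lambda>L \<in> Collect lagrangian. gauge_image M L)"


subsection \<open>Zariski-open sets of symmetric matrices\<close>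

definition sym_matrices :: "(complex ^ tet ^ tet) set" where
  "sym_matrices = {F. transpose F = F}"

inductive_set matrix_polys :: "(complex ^ tet ^ tet \<Rightarrow> complex) set" where
  const: "(\<lambda>F. c) \<in> matrix_polys"
| entry: "(\<lambda>F. F $ t $ t') \<in> matrix_polys"
| add: "p \<in> matrix_polys \<Longrightarrow> q \<in> matrix_polys \<Longrightarrow> (\<lambda>F. p F + q F) \<in> matrix_polys"
| mult: "p \<in> matrix_polys \<Longrightarrow> q \<in> matrix_polys \<Longrightarrow> (\<lambda>F. p F * q F) \<in> matrix_polys"

definition zariski_open_sym :: "(complex ^ tet ^ tet) set \<Rightarrow> bool" where
  "zariski_open_sym U \<longleftrightarrow>
     (\<exists>P \<subseteq> matrix_polys. U = {F \<in> sym_matrices. \<exists>p\<in>P. p F \<noteq> 0})"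

end

theory Submission
  imports Defs
begin

text \<open>
  In the coordinates of \<open>V\<^sub>u\<close>, the subspace \<open>V\<^sub>L F\<close> is the graph of \<open>F\<close>, so it amounts to five planes
  \<open>W\<^sub>t = span {e\<^sub>t, e\<^sub>t F}\<close> in \<open>\<complex>\<^sup>5\<close> with bivectors \<open>\<omega>\<^sub>t = e\<^sub>t \<and> e\<^sub>t F\<close>, whose sum is \<open>0\<close> by the symmetry
  of \<open>F\<close>; two such subspaces are gauge equivalent iff their tuples of bivectors are related by
  \<open>GL\<^sub>5\<close>. Four generic planes have a basis \<open>P, Q, R, S, Z\<close> of \<open>\<complex>\<^sup>5\<close> in which they are
  \<open>\<langle>P, Q\<rangle>\<close>, \<open>\<langle>S, R\<rangle>\<close>, \<open>\<langle>Z, P + R\<rangle>\<close>, \<open>\<langle>Q + S, Z + P + Q\<rangle>\<close>. As \<open>\<omega>\<^sub>1 + \<omega>\<^sub>2 + \<omega>\<^sub>3 + \<omega>\<^sub>4 = - \<omega>\<^sub>5\<close> is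
  decomposable, the \<open>\<omega>\<^sub>t\<close> are then determined up to one common factor, which a complex rescaling
  removes. So there are no moduli. Solving for the basis gives gauge matrices whose entries are
  polynomials in the entries of \<open>F\<close> and which all have the same determinant; the open set is the
  locus where that determinant does not vanish.
\<close>

subsection \<open>The normal form\<close>

lemma exhaust_5:
  fixes t :: 5
  shows "t = 1 \<or> t = 2 \<or> t = 3 \<or> t = 4 \<or> t = 5"
proof (induct t)
  case (of_int z)
  then have "z = 0 \<or> z = 1 \<or> z = 2 \<or> z = 3 \<or> z = 4" by fastforce
  then show ?case by auto
qed

lemma forall_5: "(\<forall>t::5. P t) \<longleftrightarrow> P 1 \<and> P 2 \<and> P 3 \<and> P 4 \<and> P 5"
  by (metis exhaust_5)

lemma UNIV_5: "UNIV = {1, 2, 3, 4, 5::5}"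
  using exhaust_5 by auto

lemma sum_5: "sum f (UNIV::5 set) = f 1 + f 2 + f 3 + f 4 + f 5"
  unfolding UNIV_5 by (simp add: ac_simps)

definition graph_coords :: "complex ^ 5 ^ 5 \<Rightarrow> complex ^ 5 \<Rightarrow> 5 \<Rightarrow> complex ^ 2" where
  "graph_coords F a t = vector [a $ t, (F *v a) $ t]"

definition minor2 :: "complex ^ 5 ^ 5 \<Rightarrow> 5 \<Rightarrow> 5 \<Rightarrow> 5 \<Rightarrow> 5 \<Rightarrow> complex" where
  "minor2 F i j k l = F $ i $ k * F $ j $ l - F $ i $ l * F $ j $ k"

text \<open>If \<open>a\<close> lists the first members P, S, Z, Q + S, P + Q + R + S of the pairs
  chosen below, then \<open>normal_form *v a\<close> lists the second members Q, R, -(P + R), Z + P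
  + Q, S - Z.\<close>

definition normal_form :: "complex ^ 5 ^ 5" where
  "normal_form = (\<chi> i j.
     if (i, j) \<in> {(1,2), (2,1), (2,4), (4,2), (3,5), (5,3)} then -1
     else if (i, j) \<in> {(1,4), (4,1), (2,5), (5,2), (3,4), (4,3), (4,4)} then 1 else 0)"

text \<open>
  Here \<open>mk \<alpha> \<beta> \<gamma> \<delta>\<close> is the adjugate of the matrix with rows \<open>(\<alpha>, \<beta>)\<close>, \<open>(\<gamma>, \<delta>)\<close>, which give two
  row vectors in the plane \<open>W\<^sub>t = span {e\<^sub>t, e\<^sub>t F}\<close>. For \<open>t = 1, \<dots>, 5\<close> these are the pairs
  \<open>(P, Q)\<close>, \<open>(S, R)\<close>, \<open>(Z, -(P + R))\<close>, \<open>(Q + S, Z + P + Q)\<close>, \<open>(P + Q + R + S, S - Z)\<close> for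
  vectors \<open>P, Q, R, S, Z\<close>, which are unique up to a common factor. The coefficient of \<open>e\<^sub>t F\<close> is
  a minor: \<open>p\<close> in \<open>P\<close>, \<open>q\<close> in \<open>Q\<close>, and so on; \<open>u, v, w, y, n\<close> belong to \<open>P + R\<close>, \<open>Q + S\<close>,
  \<open>P + Q + R + S\<close>, \<open>Z + P + Q\<close>, \<open>S - Z\<close>.
\<close>

definition normalizing_gauge :: "complex ^ 5 ^ 5 \<Rightarrow> 5 \<Rightarrow> complex ^ 2 ^ 2" where
  "normalizing_gauge F t =
    (let x = (\<lambda>i j. F $ i $ j); m = minor2 F;
         p = - m 2 3 4 5; q = m 2 4 3 5; r = m 1 3 4 5; s = - m 1 4 3 5;
         u = m 1 2 4 5; v = - m 1 2 3 5; w = - m 1 2 3 4;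
         z = - m 1 4 2 5; y = - m 1 3 2 5; n = m 1 4 2 3;
         mk = (\<lambda>\<alpha> \<beta> \<gamma> \<delta>. vector [vector [\<delta>, - \<beta>], vector [- \<gamma>, \<alpha>]])
     in if t = 1 then mk (u * x 1 3 - r * x 1 2 - p * x 1 1) p (v * x 1 4 - s * x 1 2 - q * x 1 1) q
        else if t = 2 then mk (v * x 2 4 - q * x 1 2 - s * x 2 2) s (u * x 2 3 - p * x 1 2 - r * x 2 2) r
        else if t = 3 then mk (y * x 3 4 - (p + q) * x 1 3 - z * x 3 3) z (u * x 3 3 - p * x 1 3 - r * x 2 3) (- u)
        else if t = 4 then mk (q * x 1 4 + s * x 2 4 - v * x 4 4) v (z * x 3 4 + (p + q) * x 1 4 - y * x 4 4) y
        else mk (u * x 3 5 + v * x 4 5 - w * x 5 5) w (s * x 2 5 - z * x 3 5 - n * x 5 5) n)"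

text \<open>Up to sign this is the pentad of factor analysis, of degree 5 in the off-diagonal entries.\<close>

definition pentad :: "complex ^ 5 ^ 5 \<Rightarrow> complex" where
  "pentad F = det (normalizing_gauge F 1)"

lemma sym_entry: "transpose F = F \<Longrightarrow> F $ i $ j = F $ j $ i"
  by (metis transpose_def vec_lambda_beta)

lemma mat2_vec: "(M :: complex^2^2) *v w = vector [M$1$1 * w$1 + M$1$2 * w$2, M$2$1 * w$1 + M$2$2 * w$2]"
  by (simp add: vec_eq_iff forall_2 matrix_vector_mult_def sum_2)

lemma sym_entries:
  assumes "transpose F = (F :: complex^5^5)"
  shows "F $ 2 $ 1 = F $ 1 $ 2" "F $ 3 $ 1 = F $ 1 $ 3" "F $ 4 $ 1 = F $ 1 $ 4" "F $ 5 $ 1 = F $ 1 $ 5"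
    "F $ 3 $ 2 = F $ 2 $ 3" "F $ 4 $ 2 = F $ 2 $ 4" "F $ 5 $ 2 = F $ 2 $ 5"
    "F $ 4 $ 3 = F $ 3 $ 4" "F $ 5 $ 3 = F $ 3 $ 5" "F $ 5 $ 4 = F $ 4 $ 5"
  using sym_entry[OF assms] by blast+

lemma normal_form_mult:
  "(normal_form *v a) $ 1 = a $ 4 - a $ 2"
  "(normal_form *v a) $ 2 = a $ 5 - a $ 1 - a $ 4"
  "(normal_form *v a) $ 3 = a $ 4 - a $ 5"
  "(normal_form *v a) $ 4 = a $ 1 - a $ 2 + a $ 3 + a $ 4"
  "(normal_form *v a) $ 5 = a $ 2 - a $ 3"
  by (simp_all add: normal_form_def matrix_vector_mult_def sum_5)

text \<open>With d_t these determinants, the t-th pair has wedge product d_t (e_t \<and> e_t F). The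
  five products sum to 0, which says (d_t - d_s) F_ts = 0, so the d_t agree generically and hence
  identically. Expansion verifies it.\<close>

lemma det_normalizing_gauge:
  assumes "transpose F = F"
  shows "det (normalizing_gauge F t) = pentad F"
  using exhaust_5[of t]
  by (elim disjE; simp add: pentad_def det_2 normalizing_gauge_def Let_def minor2_def sym_entries[OF assms];
      simp add: algebra_simps)

text \<open>Before taking adjugates, the matrices send \<open>graph_coords F c\<close> to the t-th
  pair evaluated at c, a point of the graph of \<open>normal_form\<close>. The adjugates reverse
  this up to the factor \<open>pentad F\<close>, which is common to all t.\<close>

lemma normalizing_gauge_graph:
  assumes "transpose F = F"
  defines "b \<equiv> \<lambda>a. \<chi> t. (normalizing_gauge F t *v graph_coords normal_form a t) $ 1"
  shows "normalizing_gauge F t *v graph_coords normal_form a t = graph_coords F (b a) t"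
proof -
  have "(normalizing_gauge F t *v graph_coords normal_form a t) $ 2 = (F *v b a) $ t"
    using exhaust_5[of t]
    by (elim disjE; simp add: b_def mat2_vec graph_coords_def normal_form_mult matrix_vector_mult_def[of F] sum_5
       normalizing_gauge_def Let_def minor2_def sym_entries[OF assms(1)];
        simp add: algebra_simps)
  then show ?thesis
    by (simp add: vec_eq_iff forall_2 graph_coords_def b_def)
qed

subsection \<open>Operators on the exponential algebra\<close>

definition coord_upd :: "complex ^ 5 \<Rightarrow> 5 \<Rightarrow> complex \<Rightarrow> complex ^ 5" where
  "coord_upd x t z = (\<chi> s. if s = t then z else x $ s)"

lemma coord_upd_self [simp]: "coord_upd x t (x $ t) = x"
  by (simp add: coord_upd_def vec_eq_iff)

lemma coord_upd_nth: "coord_upd x t z $ s = (if s = t then z else x $ s)"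
  by (simp add: coord_upd_def)

lemma partial_deriv_alt: "partial_deriv t f x = deriv (\<lambda>z. f (coord_upd x t z)) (x $ t)"
  by (simp add: partial_deriv_def coord_upd_def)

lemma exp_algebra_differentiable:
  assumes "f \<in> exp_algebra"
  shows "(\<lambda>z. f (coord_upd x t z)) field_differentiable at w"
  using assms
proof (induction rule: exp_algebra.induct)
  case (coord s)
  then show ?case by (cases "s = t") (simp_all add: coord_upd_nth)
next
  case (exp f)
  then show ?case
    using field_differentiable_compose[OF exp.IH field_differentiable_within_exp]
    by (simp add: o_def)
qed (auto intro: derivative_intros field_differentiable_add field_differentiable_mult)

lemma partial_deriv_eqI:
  "((\<lambda>z. f (coord_upd x t z)) has_field_derivative d) (at (x $ t)) \<Longrightarrow> partial_deriv t f x = d"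
  unfolding partial_deriv_alt by (rule DERIV_imp_deriv)

lemma exp_algebra_has_partial_deriv:
  "f \<in> exp_algebra \<Longrightarrow>
    ((\<lambda>z. f (coord_upd x t z)) has_field_derivative partial_deriv t f x) (at (x $ t))"
  unfolding partial_deriv_alt by (simp add: exp_algebra_differentiable DERIV_deriv_iff_field_differentiable)

lemma partial_deriv_const: "partial_deriv t (\<lambda>x. c) = (\<lambda>x. 0)"
  by (rule ext, rule partial_deriv_eqI) simp

lemma partial_deriv_coord: "partial_deriv t (\<lambda>x. x $ s) = (\<lambda>x. if s = t then 1 else 0)"
  by (rule ext, rule partial_deriv_eqI) (simp add: coord_upd_nth)

lemma partial_deriv_add:
  assumes "f \<in> exp_algebra" "g \<in> exp_algebra"
  shows "partial_deriv t (\<lambda>x. f x + g x) = (\<lambda>x. partial_deriv t f x + partial_deriv t g x)"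
  by (rule ext, rule partial_deriv_eqI)
    (intro DERIV_add exp_algebra_has_partial_deriv assms)

lemma partial_deriv_mult:
  assumes "f \<in> exp_algebra" "g \<in> exp_algebra"
  shows "partial_deriv t (\<lambda>x. f x * g x) = (\<lambda>x. partial_deriv t f x * g x + partial_deriv t g x * f x)"
  by (rule ext, rule partial_deriv_eqI)
    (use DERIV_mult[OF exp_algebra_has_partial_deriv[OF assms(1)] exp_algebra_has_partial_deriv[OF assms(2)]]
      in simp)

lemma partial_deriv_exp:
  assumes "f \<in> exp_algebra"
  shows "partial_deriv t (\<lambda>x. exp (f x)) = (\<lambda>x. exp (f x) * partial_deriv t f x)"
  by (rule ext, rule partial_deriv_eqI)
    (use DERIV_fun_exp[OF exp_algebra_has_partial_deriv[OF assms]] in simp)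

lemmas partial_deriv_simps =
  partial_deriv_const partial_deriv_coord partial_deriv_add partial_deriv_mult partial_deriv_exp

lemma partial_deriv_in_exp_algebra:
  assumes "f \<in> exp_algebra"
  shows "partial_deriv t f \<in> exp_algebra"
  using assms
  by (induction rule: exp_algebra.induct)
    (auto simp: partial_deriv_simps intro!: exp_algebra.intros)

text \<open>Structural induction on the algebra takes the place of Schwarz's theorem.\<close>

lemma partial_deriv_commute:
  assumes "f \<in> exp_algebra"
  shows "partial_deriv s (partial_deriv t f) = partial_deriv t (partial_deriv s f)"
  using assms
  by (induction rule: exp_algebra.induct)
    (simp_all add: partial_deriv_simps partial_deriv_in_exp_algebra exp_algebra.intros algebra_simps)

section \<open>Coordinates and commutators of operators\<close>

definition op_sum :: "(5 \<Rightarrow> complex ^ 2) \<Rightarrow> oprt" where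
  "op_sum w = (\<Sum>t\<in>UNIV. op_of t (w t))"

lemma sum_fun_apply: "(\<Sum>i\<in>I. f i) x = (\<Sum>i\<in>I. f i x)"
  by (induction I rule: infinite_finite_induct) simp_all

lemma op_of_apply:
  "op_of t w f x = (if f \<in> exp_algebra then w $ 1 * partial_deriv t f x + w $ 2 * (x $ t * f x) else 0)"
  by (simp add: op_of_def op_scale_def D_op_def X_op_def)

lemma op_sum_apply:
  "op_sum w f = (if f \<in> exp_algebra
     then (\<lambda>x. \<Sum>t\<in>UNIV. w t $ 1 * partial_deriv t f x + w t $ 2 * (x $ t * f x)) else (\<lambda>x. 0))"
  by (auto simp: op_sum_def sum_fun_apply op_of_apply fun_eq_iff)

lemma exp_algebra_zero: "(0 :: fn) \<in> exp_algebra"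
  using exp_algebra.const[of 0] by (simp add: zero_fun_def)

lemma exp_algebra_sum:
  "(\<And>i. i \<in> I \<Longrightarrow> f i \<in> exp_algebra) \<Longrightarrow> (\<lambda>x. \<Sum>i\<in>I. f i x) \<in> exp_algebra"
  by (induction I rule: infinite_finite_induct) (auto intro: exp_algebra.intros)

lemma op_of_in_exp_algebra: "op_of t w f \<in> exp_algebra"
proof (cases "f \<in> exp_algebra")
  case True
  then have "op_of t w f = (\<lambda>x. w $ 1 * partial_deriv t f x + w $ 2 * (x $ t * f x))"
    by (simp add: fun_eq_iff op_of_apply)
  then show ?thesis
    using True by (auto intro!: exp_algebra.intros partial_deriv_in_exp_algebra)
next
  case False
  then have "op_of t w f = 0" by (simp add: fun_eq_iff op_of_apply)
  then show ?thesis by (simp add: exp_algebra_zero)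
qed

lemma op_of_add:
  assumes "f \<in> exp_algebra" "g \<in> exp_algebra"
  shows "op_of t w (\<lambda>x. f x + g x) x = op_of t w f x + op_of t w g x"
  using assms by (simp add: op_of_apply partial_deriv_add exp_algebra.intros algebra_simps)

lemma op_of_zero: "op_of t w (\<lambda>x. 0) x = 0"
  by (simp add: op_of_apply partial_deriv_const)

lemma op_of_sum:
  assumes "\<And>i. i \<in> I \<Longrightarrow> f i \<in> exp_algebra"
  shows "op_of t w (\<lambda>x. \<Sum>i\<in>I. f i x) x = (\<Sum>i\<in>I. op_of t w (f i) x)"
  using assms
proof (induction I rule: infinite_finite_induct)
  case (insert i I)
  then have "op_of t w (\<lambda>x. f i x + (\<Sum>i\<in>I. f i x)) x = op_of t w (f i) x + op_of t w (\<lambda>x. \<Sum>i\<in>I. f i x) x"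
    by (intro op_of_add exp_algebra_sum) auto
  with insert show ?case by simp
qed (simp_all add: op_of_zero)

lemma op_of_commute:
  assumes "f \<in> exp_algebra"
  shows "op_of s v (op_of t w f) x - op_of t w (op_of s v f) x
    = (if s = t then (v $ 1 * w $ 2 - v $ 2 * w $ 1) * f x else 0)"
proof -
  have expand: "op_of t w f = (\<lambda>x. w $ 1 * partial_deriv t f x + w $ 2 * (x $ t * f x))" for t w
    using assms by (simp add: fun_eq_iff op_of_apply)
  \<comment> \<open>All but the Kronecker term is symmetric under exchanging (s, v) with (t, w) and
    cancels in the difference.\<close>
  have "op_of s v (op_of t w f) x =
    v $ 1 * (w $ 1 * partial_deriv s (partial_deriv t f) x
       + w $ 2 * ((if s = t then f x else 0) + x $ t * partial_deriv s f x))
    + v $ 2 * (x $ s * (w $ 1 * partial_deriv t f x + w $ 2 * (x $ t * f x)))" for s t v w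
    unfolding op_of_apply[of s v] expand
    using assms
    by (simp add: partial_deriv_simps partial_deriv_in_exp_algebra exp_algebra.intros algebra_simps)
  then show ?thesis
    by (simp add: partial_deriv_commute[OF assms, of s t] algebra_simps)
qed

definition symp_form :: "(5 \<Rightarrow> complex ^ 2) \<Rightarrow> (5 \<Rightarrow> complex ^ 2) \<Rightarrow> complex" where
  "symp_form v w = (\<Sum>t\<in>UNIV. v t $ 1 * w t $ 2 - v t $ 2 * w t $ 1)"

lemma commutator_op_sum:
  "commutator (op_sum v) (op_sum w) f x = (if f \<in> exp_algebra then symp_form v w * f x else 0)"
proof (cases "f \<in> exp_algebra")
  case True
  have app: "op_sum v (op_sum w f) x = (\<Sum>s\<in>UNIV. \<Sum>t\<in>UNIV. op_of s (v s) (op_of t (w t) f) x)" for v w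
  proof -
    have "op_sum w f = (\<lambda>x. \<Sum>t\<in>UNIV. op_of t (w t) f x)"
      by (simp add: fun_eq_iff op_sum_def sum_fun_apply)
    then show ?thesis
      by (simp add: op_sum_def[of v] sum_fun_apply op_of_sum op_of_in_exp_algebra)
  qed
  have "commutator (op_sum v) (op_sum w) f x =
     (\<Sum>s\<in>UNIV. \<Sum>t\<in>UNIV. op_of s (v s) (op_of t (w t) f) x)
     - (\<Sum>s\<in>UNIV. \<Sum>t\<in>UNIV. op_of t (w t) (op_of s (v s) f) x)"
    by (simp add: commutator_def app) (rule sum.swap)
  also have "\<dots> = (\<Sum>s\<in>UNIV. \<Sum>t\<in>UNIV.
      if s = t then (v s $ 1 * w t $ 2 - v s $ 2 * w t $ 1) * f x else 0)"
    by (simp add: op_of_commute[OF True] flip: sum_subtractf)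
  also have "\<dots> = symp_form v w * f x"
    by (simp add: symp_form_def sum_distrib_right)
  finally show ?thesis using True by simp
next
  case False
  then show ?thesis
    by (simp add: commutator_def op_sum_apply partial_deriv_const)
qed

lemma commutator_eq_0_iff: "commutator (op_sum v) (op_sum w) = 0 \<longleftrightarrow> symp_form v w = 0"
proof
  assume "commutator (op_sum v) (op_sum w) = 0"
  then have "commutator (op_sum v) (op_sum w) (\<lambda>x. 1) 0 = 0" by simp
  then show "symp_form v w = 0" by (simp add: commutator_op_sum exp_algebra.const)
qed (simp add: fun_eq_iff commutator_op_sum)

text \<open>The coordinates are read off from the values on the functions \<open>1\<close> and \<open>x\<^sub>t\<close>.\<close>

lemma op_sum_inject: "op_sum v = op_sum w \<longleftrightarrow> v = w"
proof
  assume eq: "op_sum v = op_sum w"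
  have 1: "op_sum u (\<lambda>x. 1) (axis t 1) = u t $ 2" for u t
    by (simp add: op_sum_apply exp_algebra.const partial_deriv_const axis_def if_distrib cong: if_cong)
  have 2: "op_sum u (\<lambda>x. x $ t) 0 = u t $ 1" for u t
    by (simp add: op_sum_apply exp_algebra.coord partial_deriv_coord if_distrib[of "(*) _"] cong: if_cong)
  show "v = w"
    by (simp add: fun_eq_iff vec_eq_iff forall_2) (metis 1 2 eq)
qed simp

section \<open>The subspaces in coordinates\<close>

lemma V_tet_eq: "V_tet t = range (op_of t)"
proof -
  have "V_tet t = {op_scale a (D_op t) + op_scale b (X_op t) | a b. True}"
    unfolding V_tet_def oprt.span_insert oprt.span_singleton
    by (auto simp: algebra_simps)
  also have "\<dots> = range (op_of t)"
    unfolding op_of_def by (auto simp: image_iff) (metis vector_2)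
  finally show ?thesis .
qed

lemma V_u_eq: "V_u = range op_sum"
proof -
  have "\<exists>w. \<forall>t. A t = op_of t (w t)" if "\<forall>t. A t \<in> V_tet t" for A
    using that unfolding V_tet_eq image_iff by metis
  then show ?thesis
    unfolding V_u_def op_sum_def by (fastforce simp: V_tet_eq)
qed

text \<open>Combining the generators with weights \<open>a\<close> gives the x-coefficients
  \<open>transpose F *v a\<close>; symmetry turns them into \<open>F *v a\<close>.\<close>

lemma V_L_eq:
  assumes "transpose F = F"
  shows "V_L F = range (\<lambda>a. op_sum (graph_coords F a))"
proof -
  define gen where "gen t = D_op t + (\<Sum>t'\<in>UNIV. op_scale (F $ t $ t') (X_op t'))" for t
  have comb: "op_sum (graph_coords F a) = (\<Sum>t\<in>UNIV. op_scale (a $ t) (gen t))" for a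
  proof -
    have "(\<Sum>t\<in>UNIV. op_scale (a $ t) (gen t)) = (\<Sum>t\<in>UNIV. op_scale (a $ t) (D_op t))
       + (\<Sum>t\<in>UNIV. \<Sum>t'\<in>UNIV. op_scale (a $ t * F $ t $ t') (X_op t'))"
      by (simp add: gen_def oprt.scale_right_distrib oprt.scale_sum_right sum.distrib)
    also have "(\<Sum>t\<in>UNIV. \<Sum>t'\<in>UNIV. op_scale (a $ t * F $ t $ t') (X_op t'))
       = (\<Sum>t'\<in>UNIV. op_scale ((F *v a) $ t') (X_op t'))"
      by (subst sum.swap)
        (simp add: matrix_vector_mult_def oprt.scale_sum_left sym_entry[OF assms] mult.commute)
    finally show ?thesis
      by (simp only: op_sum_def op_of_def graph_coords_def sum.distrib vector_2)
  qed
  have gen: "gen t = op_sum (graph_coords F (axis t 1))" for t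
    by (simp add: comb axis_def if_distrib[of "\<lambda>c. op_scale c _"] cong: if_cong)
  have lin: "op_sum (graph_coords F a) + op_sum (graph_coords F b) = op_sum (graph_coords F (a + b))"
    "op_scale c (op_sum (graph_coords F a)) = op_sum (graph_coords F (c *s a))" for a b c
    by (simp_all only: comb sum.distrib oprt.scale_sum_right oprt.scale_left_distrib
        oprt.scale_scale vector_add_component vector_smult_component)
  have "oprt.subspace (range (\<lambda>a. op_sum (graph_coords F a)))"
  proof (rule oprt.subspaceI)
    have "0 = op_sum (graph_coords F 0)" by (simp only: comb zero_index oprt.scale_zero_left sum.neutral_const)
    then show "0 \<in> range (\<lambda>a. op_sum (graph_coords F a))" by blast
  qed (auto simp: lin)
  then have "oprt.span (range gen) \<subseteq> range (\<lambda>a. op_sum (graph_coords F a))"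
    by (rule oprt.span_minimal[rotated]) (auto simp: gen)
  moreover have "op_sum (graph_coords F a) \<in> oprt.span (range gen)" for a
    unfolding comb by (intro oprt.span_sum oprt.span_scale oprt.span_base rangeI)
  ultimately show ?thesis
    unfolding V_L_def gen_def by blast
qed

text \<open>The coefficient of \<open>a $ t\<close> measures how far \<open>w\<close> is from the
  graph of \<open>F\<close> at t, which serves both isotropy and maximality of
  \<open>V_L F\<close>.\<close>

lemma symp_form_graph_coords:
  assumes "transpose F = F"
  shows "symp_form w (graph_coords F a) = (\<Sum>t\<in>UNIV. ((\<Sum>s\<in>UNIV. F $ t $ s * w s $ 1) - w t $ 2) * a $ t)"
proof -
  have "(\<Sum>t\<in>UNIV. w t $ 1 * (F *v a) $ t) = (\<Sum>t\<in>UNIV. \<Sum>s\<in>UNIV. w t $ 1 * F $ t $ s * a $ s)"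
    by (simp add: matrix_vector_mult_def sum_distrib_left mult_ac)
  also have "\<dots> = (\<Sum>s\<in>UNIV. (\<Sum>t\<in>UNIV. F $ s $ t * w t $ 1) * a $ s)"
    by (subst sum.swap) (simp add: sum_distrib_right sum_distrib_left mult_ac sym_entry[OF assms])
  finally show ?thesis
    by (simp add: symp_form_def graph_coords_def sum_subtractf left_diff_distrib)
qed

lemma lagrangian_V_L:
  assumes "transpose F = F"
  shows "lagrangian (V_L F)"
  unfolding lagrangian_def
proof (intro conjI allI impI)
  have "symp_form (graph_coords F a) (graph_coords F b) = 0" for a b
    by (simp add: symp_form_graph_coords[OF assms]) (simp add: graph_coords_def matrix_vector_mult_def)
  then show "commuting_subspace (V_L F)"
    using oprt.subspace_span[of "range (\<lambda>t. D_op t + (\<Sum>t'\<in>UNIV. op_scale (F $ t $ t') (X_op t')))"]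
    unfolding commuting_subspace_def V_L_def[symmetric]
    by (auto simp: V_L_eq[OF assms] commutator_eq_0_iff V_u_eq)
next
  fix L'
  assume L': "commuting_subspace L' \<and> V_L F \<subseteq> L'"
  have "A \<in> V_L F" if "A \<in> L'" for A
  proof -
    from that L' obtain w where w: "A = op_sum w"
      by (auto simp: commuting_subspace_def V_u_eq)
    have 0: "symp_form w (graph_coords F a) = 0" for a
      using that L' unfolding V_L_eq[OF assms] commuting_subspace_def
      by (metis w commutator_eq_0_iff range_eqI subset_iff)
    \<comment> \<open>Testing on basis vectors makes every coefficient vanish, so \<open>w\<close>
      lies on the graph.\<close>
    have "w t $ 2 = (\<Sum>s\<in>UNIV. F $ t $ s * w s $ 1)" for t
      using 0[of "axis t 1"] unfolding symp_form_graph_coords[OF assms]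
      by (simp add: axis_def if_distrib cong: if_cong)
    then have "w = graph_coords F (\<chi> t. w t $ 1)"
      by (simp add: fun_eq_iff vec_eq_iff forall_2 graph_coords_def matrix_vector_mult_def)
    then show ?thesis
      unfolding V_L_eq[OF assms] w by (rule range_eqI[OF arg_cong])
  qed
  then show "L' = V_L F"
    using L' by blast
qed

subsection \<open>The gauge orbit of the normal form\<close>

text \<open>For 2x2 matrices, \<open>transpose M ** J2 ** M\<close> is \<open>det M\<close> times
  \<open>J2\<close>.\<close>

lemma Sp2_carrier: "M \<in> carrier Sp2 \<longleftrightarrow> det M = 1"
  by (auto simp: Sp2_def J2_def vec_eq_iff forall_2 matrix_matrix_mult_def transpose_def sum_2 det_2 algebra_simps)

lemma gauge_image_op_sum:
  "gauge_image M (range (\<lambda>a. op_sum (v a))) = range (\<lambda>a. op_sum (\<lambda>t. M t *v v a t))"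
  unfolding gauge_image_def op_sum_def[symmetric] by (auto simp: op_sum_inject)

lemma transpose_normal_form: "transpose normal_form = normal_form"
  by (simp add: vec_eq_iff forall_5 transpose_def normal_form_def)

lemma graph_coords_lin:
  "graph_coords F (a + b) t = graph_coords F a t + graph_coords F b t"
  "graph_coords F (c *s a) t = c *s graph_coords F a t"
  by (simp_all add: vec_eq_iff forall_2 graph_coords_def vec.add vec.scale)

text \<open>Ensures that the gauge image is all of \<open>V_L F\<close>, not a proper subspace. The
  gauge matrices are invertible, so the kernel is zero.\<close>

lemma normalizing_gauge_surj:
  assumes "transpose F = F" and "pentad F \<noteq> 0"
  shows "surj (\<lambda>a. \<chi> t. (normalizing_gauge F t *v graph_coords normal_form a t) $ 1)" (is "surj ?b")
proof -
  have lin: "Vector_Spaces.linear (*s) (*s) ?b"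
    by unfold_locales (simp_all add: vec_eq_iff graph_coords_lin vec.add vec.scale)
  moreover have "a = 0" if "?b a = 0" for a
  proof -
    have "graph_coords normal_form a t = 0" for t
    proof -
      have "normalizing_gauge F t *v graph_coords normal_form a t = graph_coords F 0 t"
        using normalizing_gauge_graph[OF assms(1), of t a] that by simp
      also have "\<dots> = 0" by (simp add: vec_eq_iff forall_2 graph_coords_def)
      finally show ?thesis
        using assms det_normalizing_gauge[OF assms(1), of t]
        by (metis invertible_def invertible_det_nz matrix_vector_mul_assoc matrix_vector_mul_lid
            matrix_vector_mult_0_right)
    qed
    then have "graph_coords normal_form a t $ 1 = 0" for t by simp
    then show ?thesis by (simp add: vec_eq_iff graph_coords_def)
  qed
  ultimately have "inj ?b"
    by (subst vec.linear_inj_iff_eq_0) auto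
  with lin show ?thesis
    by (rule vec.linear_injective_imp_surjective) (rule refl)
qed

lemma V_L_in_orbit_normal_form:
  assumes "transpose F = F" and "pentad F \<noteq> 0"
  shows "V_L F \<in> orbit gauge_group gauge_action (V_L normal_form)"
proof -
  \<comment> \<open>Scaling a 2x2 matrix by c multiplies its determinant by c squared, so one c
    brings all five matrices into \<open>Sp2\<close>.\<close>
  define c where "c = 1 / csqrt (pentad F)"
  have c: "c \<noteq> 0" "c\<^sup>2 * pentad F = 1"
    using assms(2) by (simp_all add: c_def power_divide)
  define M where "M t = (\<chi> i. c *s normalizing_gauge F t $ i)" for t
  have M_mult: "M t *v w = c *s (normalizing_gauge F t *v w)" for t w
    by (simp add: M_def vec_eq_iff matrix_vector_mult_def sum_distrib_left mult.assoc)
  have "det (M t) = 1" for t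
    using c(2) det_normalizing_gauge[OF assms(1), of t]
    by (simp add: M_def det_2 power2_eq_square algebra_simps)
  then have M: "M \<in> carrier gauge_group"
    by (auto simp: gauge_group_def Sp2_carrier)
  define b where "b a = (\<chi> t. (normalizing_gauge F t *v graph_coords normal_form a t) $ 1)" for a
  have "normalizing_gauge F t *v graph_coords normal_form a t = graph_coords F (b a) t" for a t
    using normalizing_gauge_graph[OF assms(1)] unfolding b_def .
  then have "M t *v graph_coords normal_form a t = graph_coords F (c *s b a) t" for a t
    by (simp add: M_mult graph_coords_lin)
  then have "gauge_image M (V_L normal_form) = range (\<lambda>a. op_sum (graph_coords F (c *s b a)))"
    by (simp add: V_L_eq[OF transpose_normal_form] gauge_image_op_sum)
  also have "\<dots> = (\<lambda>a. op_sum (graph_coords F a)) ` range (\<lambda>a. c *s b a)"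
    by (simp add: image_image)
  also have "range (\<lambda>a. c *s b a) = UNIV"
  proof -
    have "\<exists>a. d = c *s b a" for d
    proof -
      obtain a where "(1 / c) *s d = b a"
        using surjD[OF normalizing_gauge_surj[OF assms], of "(1 / c) *s d"] unfolding b_def by (elim exE)
      then have "c *s b a = d"
        using c(1) by (simp flip: \<open>(1 / c) *s d = b a\<close>)
      then show ?thesis by blast
    qed
    then show ?thesis by blast
  qed
  finally have "V_L F = gauge_action M (V_L normal_form)"
    by (simp add: gauge_action_def lagrangian_V_L[OF transpose_normal_form] V_L_eq[OF assms(1)])
  with M show ?thesis
    unfolding orbit_def by blast
qed

section \<open>The Zariski-open set\<close>

lemma matrix_polys_diff:
  assumes "p \<in> matrix_polys" "q \<in> matrix_polys"
  shows "(\<lambda>F. p F - q F) \<in> matrix_polys"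
  using matrix_polys.add[OF assms(1) matrix_polys.mult[OF matrix_polys.const[of "-1"] assms(2)]]
  by simp

lemma matrix_polys_uminus: "p \<in> matrix_polys \<Longrightarrow> (\<lambda>F. - p F) \<in> matrix_polys"
  using matrix_polys_diff[OF matrix_polys.const[of 0], of p] by simp

lemma pentad_in_matrix_polys: "pentad \<in> matrix_polys"
  unfolding pentad_def[abs_def] det_2 normalizing_gauge_def Let_def minor2_def if_P[OF refl] vector_2
  by (intro matrix_polys_diff matrix_polys_uminus matrix_polys.mult matrix_polys.add matrix_polys.entry)

lemma pentad_normal_form: "pentad normal_form = 1"
  by (simp add: pentad_def det_2 normalizing_gauge_def minor2_def normal_form_def)

theorem theorem1:
  shows "\<exists>U. zariski_open_sym U \<and> U \<noteq> {} \<and>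
    (\<exists>Orb \<in> orbits gauge_group (Collect lagrangian) gauge_action.
       \<forall>F\<in>U. V_L F \<in> Orb)"
proof (intro exI conjI bexI ballI)
  let ?U = "{F \<in> sym_matrices. \<exists>p\<in>{pentad}. p F \<noteq> 0}"
  show "zariski_open_sym ?U"
    unfolding zariski_open_sym_def using pentad_in_matrix_polys by blast
  show "?U \<noteq> {}"
    using transpose_normal_form pentad_normal_form by (auto simp: sym_matrices_def)
  show "orbit gauge_group gauge_action (V_L normal_form)
      \<in> orbits gauge_group (Collect lagrangian) gauge_action"
    unfolding orbits_def using lagrangian_V_L[OF transpose_normal_form] by blast
  show "V_L F \<in> orbit gauge_group gauge_action (V_L normal_form)" if "F \<in> ?U" for F
    using that V_L_in_orbit_normal_form by (auto simp: sym_matrices_def)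
qed

end
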